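(* Let $X$ be a vector field of class $\mathcal{C}^{1}$ on $\mathbb{R}^{n}$ and let $b:\mathbb{R}^n\times\mathbb{R}^n\to\mathbb{R}$ be a geometric structure on $\mathbb{R}^{n}$ (i.e. a nondegenerate real bilinear form). Then the following assertions hold. (i) There exists a unique global decomposition $$X(\mathbf{x})=\nabla^{R}_{b}H(\mathbf{x})+\mathbf{u}(\mathbf{x}),\quad \forall \mathbf{x}\in\mathbb{R}^{n},$$ with $H\in\mathcal{C}^1(\mathbb{R}^n,\mathbb{R})$ and $\mathbf{u}$ a vector field on $\mathbb{R}^n$ such that $H(\mathbf{0})=0$ and $b(\mathbf{x},\mathbf{u}(\mathbf{x}))=0$ for all $\mathbf{x}\in\mathbb{R}^{n}$. (ii) There exists a unique global decomposition $$X(\mathbf{x})=\nabla^{L}_{b}H^{\star}(\mathbf{x})+\mathbf{u}^{\star}(\mathbf{x}),\quad \forall \mathbf{x}\in\mathbb{R}^{n},$$ with $H^\star\in\mathcal{C}^1(\mathbb{R}^n,\mathbb{R})$ and $\mathbf{u}^\star$ a vector field on $\mathbb{R}^n$ such that $H^{\star}(\mathbf{0})=0$ and $b(\mathbf{u}^{\star}(\mathbf{x}),\mathbf{x})=0$ for all $\mathbf{x}\in\mathbb{R}^{n}$. (iii) The functions $H$ of (i) and $H^{\star}$ of (ii) are related by $$H^{\star}(\mathbf{x})=H(\mathbf{x})+2\int_{0}^{1}\mathcal{A}_{b}(X(t\mathbf{x}),\mathbf{x})\,\mathrm{d}t,\quad \forall\mathbf{x}\in\mathbb{R}^{n},$$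 where $\mathcal{A}_{b}(\mathbf{x},\mathbf{y}):=\frac12\left(b(\mathbf{x},\mathbf{y})-b(\mathbf{y},\mathbf{x})\right)$ is the skew-symmetric part of $b$. (iv) If $b$ is symmetric, then $H^{\star}=H$ and $\mathbf{u}^{\star}=\mathbf{u}$; if $b$ is skew-symmetric, then $H^{\star}=-H$ and $\mathbf{u}^{\star}=\mathbf{u}$. (v) If $b$ is symmetric or skew-symmetric, there exists a unique global decomposition $$X(\mathbf{x})=\nabla_{b}H(\mathbf{x})+\mathbf{u}(\mathbf{x}),\quad\forall\mathbf{x}\in\mathbb{R}^{n},$$ with $H\in\mathcal{C}^1(\mathbb{R}^n,\mathbb{R})$ and $\mathbf{u}$ a vector field on $\mathbb{R}^n$ such that $H(\mathbf{0})=0$ and $b(\mathbf{u}(\mathbf{x}),\mathbf{x})=b(\mathbf{x},\mathbf{u}(\mathbf{x}))=0$ for all $\mathbf{x}\in\mathbb{R}^{n}$. When $b$ is skew-symmetric (i.e. a symplectic form), $\nabla_b H$ coincides with the Hamiltonian vector field $X_H$ of $H$ with respect to $b$.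
   Context: A geometric structure on $\mathbb{R}^n$ is a nondegenerate real bilinear form $b:\mathbb{R}^n\times\mathbb{R}^n\to\mathbb{R}$ (not necessarily symmetric or skew-symmetric). For $F\in\mathcal{C}^1(\mathbb{R}^n,\mathbb{R})$, the left-gradient $\nabla^L_bF$ and right-gradient $\nabla^R_bF$ are the vector fields uniquely defined by $$b(\nabla^{L}_{b}F(\mathbf{x}),\mathbf{v})=\mathrm{d}F(\mathbf{x})\cdot\mathbf{v},\qquad b(\mathbf{v},\nabla^{R}_{b}F(\mathbf{x}))=\mathrm{d}F(\mathbf{x})\cdot\mathbf{v},\qquad\forall\mathbf{x},\mathbf{v}\in\mathbb{R}^{n}.$$ If $b$ is symmetric then $\nabla^L_b=\nabla^R_b$, and if $b$ is skew-symmetric then $\nabla^L_b=-\nabla^R_b$; in both of these cases one writes $\nabla_bF:=\nabla^L_bF$. The Hamiltonian vector field $X_H$ of $H$ with respect to a symplectic form $b$ is defined by $b(X_H(\mathbf{x}),\mathbf{v})=\mathrm{d}H(\mathbf{x})\cdot\mathbf{v}$ for all $\mathbf{x},\mathbf{v}$. In each decomposition, "unique" means that the pair (potential function, remaining vector field) is unique among pairs with the stated properties. *)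

theory Defs
  imports "HOL-Analysis.Analysis"
begin

definition C1 :: "('a::real_normed_vector \<Rightarrow> 'b::real_normed_vector) \<Rightarrow> bool" where
  "C1 f \<longleftrightarrow>
     (\<exists>f' :: 'a \<Rightarrow> 'a \<Rightarrow>\<^sub>L 'b.
        (\<forall>x. (f has_derivative blinfun_apply (f' x)) (at x)) \<and> continuous_on UNIV f')"

definition nondegenerate :: "('a::real_vector \<Rightarrow> 'a \<Rightarrow> real) \<Rightarrow> bool" where
  "nondegenerate b \<longleftrightarrow>
     (\<forall>x. (\<forall>y. b x y = 0) \<longrightarrow> x = 0) \<and> (\<forall>y. (\<forall>x. b x y = 0) \<longrightarrow> y = 0)"

definition geometric_structure :: "('a::euclidean_space \<Rightarrow> 'a \<Rightarrow> real) \<Rightarrow> bool" where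
  "geometric_structure b \<longleftrightarrow> bilinear b \<and> nondegenerate b"

definition symmetric_form :: "('a \<Rightarrow> 'a \<Rightarrow> real) \<Rightarrow> bool" where
  "symmetric_form b \<longleftrightarrow> (\<forall>x y. b x y = b y x)"

definition skew_symmetric_form :: "('a \<Rightarrow> 'a \<Rightarrow> real) \<Rightarrow> bool" where
  "skew_symmetric_form b \<longleftrightarrow> (\<forall>x y. b x y = - b y x)"

definition skew_part :: "('a \<Rightarrow> 'a \<Rightarrow> real) \<Rightarrow> 'a \<Rightarrow> 'a \<Rightarrow> real" where
  "skew_part b x y = (b x y - b y x) / 2"

text \<open>The descriptions below denote a unique vector field when \<open>b\<close> is a geometric structure and
  \<open>F\<close> is differentiable; they are unspecified otherwise.\<close>

definition left_gradient ::
    "('a::euclidean_space \<Rightarrow> 'a \<Rightarrow> real) \<Rightarrow> ('a \<Rightarrow> real) \<Rightarrow> 'a \<Rightarrow> 'a" where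
  "left_gradient b F = (THE G. \<forall>x v. b (G x) v = frechet_derivative F (at x) v)"

definition right_gradient ::
    "('a::euclidean_space \<Rightarrow> 'a \<Rightarrow> real) \<Rightarrow> ('a \<Rightarrow> real) \<Rightarrow> 'a \<Rightarrow> 'a" where
  "right_gradient b F = (THE G. \<forall>x v. b v (G x) = frechet_derivative F (at x) v)"

text \<open>Meaningful for symmetric or skew-symmetric \<open>b\<close> only; in the skew-symmetric case the left
  gradient is the one chosen.\<close>

definition gradient ::
    "('a::euclidean_space \<Rightarrow> 'a \<Rightarrow> real) \<Rightarrow> ('a \<Rightarrow> real) \<Rightarrow> 'a \<Rightarrow> 'a" where
  "gradient b F = left_gradient b F"

definition is_hamiltonian_vector_field ::
    "('a::euclidean_space \<Rightarrow> 'a \<Rightarrow> real) \<Rightarrow> ('a \<Rightarrow> real) \<Rightarrow> ('a \<Rightarrow> 'a) \<Rightarrow> bool" where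
  "is_hamiltonian_vector_field b H Y \<longleftrightarrow>
     (\<forall>x v. b (Y x) v = frechet_derivative H (at x) v)"

definition right_decomposition ::
    "('a::euclidean_space \<Rightarrow> 'a \<Rightarrow> real) \<Rightarrow> ('a \<Rightarrow> 'a) \<Rightarrow> ('a \<Rightarrow> real) \<Rightarrow> ('a \<Rightarrow> 'a) \<Rightarrow> bool" where
  "right_decomposition b X H u \<longleftrightarrow>
     C1 H \<and> (\<forall>x. X x = right_gradient b H x + u x) \<and> H 0 = 0 \<and> (\<forall>x. b x (u x) = 0)"

definition left_decomposition ::
    "('a::euclidean_space \<Rightarrow> 'a \<Rightarrow> real) \<Rightarrow> ('a \<Rightarrow> 'a) \<Rightarrow> ('a \<Rightarrow> real) \<Rightarrow> ('a \<Rightarrow> 'a) \<Rightarrow> bool" where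
  "left_decomposition b X H u \<longleftrightarrow>
     C1 H \<and> (\<forall>x. X x = left_gradient b H x + u x) \<and> H 0 = 0 \<and> (\<forall>x. b (u x) x = 0)"

definition gradient_decomposition ::
    "('a::euclidean_space \<Rightarrow> 'a \<Rightarrow> real) \<Rightarrow> ('a \<Rightarrow> 'a) \<Rightarrow> ('a \<Rightarrow> real) \<Rightarrow> ('a \<Rightarrow> 'a) \<Rightarrow> bool" where
  "gradient_decomposition b X H u \<longleftrightarrow>
     C1 H \<and> (\<forall>x. X x = gradient b H x + u x) \<and> H 0 = 0 \<and>
     (\<forall>x. b (u x) x = 0 \<and> b x (u x) = 0)"

end

theory Submission
  imports Defs
begin

text \<open>Pairing \<open>X = right_gradient b H + u\<close> with \<open>x\<close> on the left eliminates \<open>u\<close> and leaves the radial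
  equation \<open>dH(x) x = b x (X x)\<close>. Integrating it along the segment from \<open>0\<close> to \<open>x\<close> forces
  \<open>H x = \<integral>\<^sub>0\<^sup>1 b x (X (t x)) dt\<close>, and differentiating this integral shows that it does solve
  the equation. The left decomposition is the right decomposition for the transposed form.\<close>

section \<open>Transposition of the form\<close>

lemma bilinear_transpose: "bilinear b \<Longrightarrow> bilinear (\<lambda>x y. b y x)"
  by (simp add: bilinear_def)

lemma geometric_structure_transpose:
  "geometric_structure b \<Longrightarrow> geometric_structure (\<lambda>x y. b y x)"
  by (auto simp: geometric_structure_def nondegenerate_def bilinear_transpose)

lemma left_gradient_transpose: "left_gradient b = right_gradient (\<lambda>x y. b y x)"
  by (simp add: fun_eq_iff left_gradient_def right_gradient_def)

lemma left_decomposition_transpose: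
  "left_decomposition b = right_decomposition (\<lambda>x y. b y x)"
  by (simp add: fun_eq_iff left_decomposition_def right_decomposition_def left_gradient_transpose)

section \<open>Representing functionals and defining gradients\<close>

text \<open>Nondegeneracy makes the map from \<open>y\<close> to the functional \<open>b _ y\<close>
  injective. Identifying functionals with vectors through the inner product turns it into an
  endomorphism, which is surjective by finite dimension.\<close>

lemma ex1_right_representative:
  fixes b :: "'a::euclidean_space \<Rightarrow> 'a \<Rightarrow> real"
  assumes b: "geometric_structure b" and L: "linear L"
  shows "\<exists>!y. \<forall>v. b v y = L v"
proof -
  have bil: "bilinear b"
    using b by (simp add: geometric_structure_def)
  have lin1: "linear (\<lambda>v. b v y)" and lin2: "linear (\<lambda>y. b v y)" for v y
    using bil by (auto simp: bilinear_def)
  have nondeg: "y = 0" if "\<And>v. b v y = 0" for y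
    using b that by (auto simp: geometric_structure_def nondegenerate_def)
  \<comment> \<open>This sum is the Riesz vector of \<open>f\<close> for the inner product. It
    serves twice: for the functionals \<open>b _ y\<close>, which gives \<open>B\<close>, and for
    the target \<open>L\<close>.\<close>
  have inner: "v \<bullet> (\<Sum>i\<in>Basis. f i *\<^sub>R i) = f v" if "linear f" for f :: "'a \<Rightarrow> real" and v
  proof -
    have "f v = f (\<Sum>i\<in>Basis. (v \<bullet> i) *\<^sub>R i)"
      by (simp add: euclidean_representation)
    also have "\<dots> = (\<Sum>i\<in>Basis. (v \<bullet> i) * f i)"
      using that by (simp add: linear_sum linear_cmul)
    finally show ?thesis
      by (simp add: inner_sum_right mult.commute)
  qed
  define B where "B y = (\<Sum>i\<in>Basis. b i y *\<^sub>R i)" for y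
  have B: "v \<bullet> B y = b v y" for v y
    unfolding B_def by (rule inner[OF lin1])
  have "linear B"
    unfolding B_def
    by (intro linear_compose_sum ballI linearI)
       (simp_all add: linear_add[OF lin2] linear_cmul[OF lin2] scaleR_add_left)
  moreover have "inj B"
    unfolding linear_injective_0[OF \<open>linear B\<close>] using nondeg B by (metis inner_zero_right)
  ultimately have "surj B"
    by (rule linear_injective_imp_surjective) simp
  then obtain y where "(\<Sum>i\<in>Basis. L i *\<^sub>R i) = B y"
    by (metis surjD)
  then have "\<forall>v. b v y = L v"
    using inner[OF L] B by metis
  moreover have "y = z" if "\<forall>v. b v y = L v" "\<forall>v. b v z = L v" for y z
    using nondeg[of "y - z"] that by (simp add: linear_diff[OF lin2])
  ultimately show ?thesis
    by blast
qed

lemma C1_has_derivative: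
  "C1 F \<Longrightarrow> (F has_derivative frechet_derivative F (at x)) (at x)"
  unfolding C1_def using frechet_derivative_works differentiable_def by blast

text \<open>Pointwise unique representatives assemble into a unique field, so the definite
  description is well defined. The equivalence both yields the defining equation of the gradient and
  recognises a given field as the gradient.\<close>

lemma right_gradient_unique:
  fixes F :: "'a::euclidean_space \<Rightarrow> real"
  assumes b: "geometric_structure b" and F: "C1 F"
  shows "(\<forall>x v. b v (G x) = frechet_derivative F (at x) v) \<longleftrightarrow> G = right_gradient b F"
proof -
  have "\<exists>!y. \<forall>v. b v y = frechet_derivative F (at x) v" for x
    using C1_has_derivative[OF F] has_derivative_linear ex1_right_representative[OF b] by blast
  then have "\<exists>!G. \<forall>x v. b v (G x) = frechet_derivative F (at x) v"
    by (metis (no_types, lifting) ext)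
  from theI'[OF this] this show ?thesis
    unfolding right_gradient_def by blast
qed

lemmas right_gradient = right_gradient_unique[THEN iffD2, OF _ _ refl, rule_format]

lemma left_gradient_unique:
  fixes F :: "'a::euclidean_space \<Rightarrow> real"
  assumes b: "geometric_structure b" and F: "C1 F"
  shows "(\<forall>x v. b (G x) v = frechet_derivative F (at x) v) \<longleftrightarrow> G = left_gradient b F"
  using right_gradient_unique[OF geometric_structure_transpose[OF b] F]
  by (simp add: left_gradient_transpose)

section \<open>The radial equation and its solution\<close>

text \<open>Since \<open>b x (right_gradient b H x)\<close> is the derivative of \<open>H\<close> at
  \<open>x\<close> along \<open>x\<close>, the orthogonality of the remainder is exactly the radial
  equation. What is left to solve is a scalar problem for \<open>H\<close>, which then determines
  \<open>u\<close>.\<close>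

lemma right_decomposition_iff:
  fixes b :: "'a::euclidean_space \<Rightarrow> 'a \<Rightarrow> real"
  assumes b: "geometric_structure b"
  shows "right_decomposition b X H u \<longleftrightarrow>
    C1 H \<and> H 0 = 0 \<and> (\<forall>x. frechet_derivative H (at x) x = b x (X x)) \<and>
    u = (\<lambda>x. X x - right_gradient b H x)"
proof (cases "C1 H")
  case True
  have "b x (X x - right_gradient b H x) = b x (X x) - frechet_derivative H (at x) x" for x
    using b by (simp add: bilinear_rsub geometric_structure_def right_gradient[OF b True])
  then show ?thesis
    using True by (auto simp: right_decomposition_def)
qed (simp add: right_decomposition_def)

text \<open>The radial equation is only used at \<open>t > 0\<close>, where \<open>t *\<^sub>R x\<close> can be divided by \<open>t\<close>.\<close>

lemma radial_derivative_has_integral: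
  fixes b :: "'a::euclidean_space \<Rightarrow> 'a \<Rightarrow> real"
  assumes b: "bilinear b" and H: "C1 H"
    and rad: "\<And>x. frechet_derivative H (at x) x = b x (X x)"
  shows "((\<lambda>t. b x (X (t *\<^sub>R x))) has_integral (H x - H 0)) {0..1}"
proof -
  have deriv: "((\<lambda>t. H (t *\<^sub>R x)) has_vector_derivative frechet_derivative H (at (t *\<^sub>R x)) x) (at t)"
    for t :: real
  proof -
    have "((\<lambda>t. t *\<^sub>R x) has_vector_derivative x) (at t)"
      by (auto intro!: derivative_eq_intros)
    from vector_derivative_diff_chain_within[OF this has_derivative_at_withinI, OF C1_has_derivative[OF H]]
    show ?thesis
      by (simp add: o_def)
  qed
  have "b x (X (t *\<^sub>R x)) = frechet_derivative H (at (t *\<^sub>R x)) x" if "0 < t" for t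
  proof -
    have "t * frechet_derivative H (at (t *\<^sub>R x)) x = t * b x (X (t *\<^sub>R x))"
      using rad[of "t *\<^sub>R x"] b has_derivative_linear[OF C1_has_derivative[OF H]]
      by (simp add: linear_cmul bilinear_lmul)
    with that show ?thesis
      by simp
  qed
  moreover have "continuous_on {0..1} (\<lambda>t. H (t *\<^sub>R x))"
    using deriv by (intro continuous_at_imp_continuous_on ballI)
      (blast intro: has_vector_derivative_continuous)
  \<comment> \<open>The interior form of the fundamental theorem asks for the derivative on the open
    interval only, and for continuity on the closed one, so the excluded point \<open>t = 0\<close>
    does no harm.\<close>
  ultimately have "((\<lambda>t. b x (X (t *\<^sub>R x))) has_integral (H (1 *\<^sub>R x) - H (0 *\<^sub>R x))) {0..1}"
    using deriv by (intro fundamental_theorem_of_calculus_interior) auto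
  then show ?thesis
    by simp
qed

text \<open>The derivative of the potential along \<open>x\<close> is the integral over \<open>{0..1}\<close> of the derivative of
  \<open>t * b x (X (t *\<^sub>R x))\<close> with respect to \<open>t\<close>.\<close>

lemma radial_potential:
  fixes b :: "'a::euclidean_space \<Rightarrow> 'a \<Rightarrow> real"
  assumes b: "bilinear b" and X: "C1 X"
  defines "H \<equiv> \<lambda>x. integral {0..1} (\<lambda>t. b x (X (t *\<^sub>R x)))"
  shows "C1 H" and "frechet_derivative H (at x) x = b x (X x)"
proof -
  interpret bounded_bilinear b
    using b by (simp add: bilinear_conv_bounded_bilinear)
  obtain X' where X': "\<And>x. (X has_derivative blinfun_apply (X' x)) (at x)"
    and cont_X': "continuous_on UNIV X'"
    using X by (auto simp: C1_def)
  have cont_X: "continuous_on UNIV X"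
    using X' has_derivative_continuous by (intro continuous_at_imp_continuous_on) blast
  \<comment> \<open>The derivative of the integrand in \<open>x\<close>, by the product rule; the
    factor \<open>t\<close> comes from the inner map \<open>t *\<^sub>R x\<close>. It is bundled as
    a bounded operator because \<open>C1\<close> and the Leibniz rule ask for continuity in operator
    norm.\<close>
  define h' where "h' x t = Blinfun (\<lambda>v. b v (X (t *\<^sub>R x)) + t * b x (X' (t *\<^sub>R x) v))"
    for x and t :: real
  have h'_apply: "blinfun_apply (h' x t) = (\<lambda>v. b v (X (t *\<^sub>R x)) + t * b x (X' (t *\<^sub>R x) v))" for x t
    unfolding h'_def
    by (intro bounded_linear_Blinfun_apply bounded_linear_add bounded_linear_left
        bounded_linear_const_mult bounded_linear_compose[OF bounded_linear_right]
        blinfun.bounded_linear_right)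
  have deriv: "((\<lambda>x. b x (X (t *\<^sub>R x))) has_derivative h' x t) (at x)" for x t
  proof -
    have "((\<lambda>x. X (t *\<^sub>R x)) has_derivative (\<lambda>v. X' (t *\<^sub>R x) (t *\<^sub>R v))) (at x)"
      using has_derivative_compose[OF has_derivative_scaleR_right[OF has_derivative_ident] X'] .
    from FDERIV[OF has_derivative_ident this] show ?thesis
      by (simp add: h'_apply blinfun.scaleR_right scaleR_right add.commute)
  qed
  have cont: "continuous_on S (\<lambda>p. X (snd p *\<^sub>R fst p))"
    "continuous_on S (\<lambda>p. X' (snd p *\<^sub>R fst p))" for S :: "('a \<times> real) set"
    by (intro continuous_on_compose2[OF cont_X] continuous_on_compose2[OF cont_X']
        continuous_intros; simp)+
  have cont_h': "continuous_on (UNIV \<times> cbox 0 1) (\<lambda>(x, t). h' x t)"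
    unfolding case_prod_beta
    \<comment> \<open>In finite dimension, continuity in operator norm can be checked on each basis
      vector.\<close>
    by (rule continuous_on_blinfun_componentwise)
       (simp add: h'_apply, intro continuous_intros continuous_on cont)
  have integrable: "(\<lambda>t. b x (X (t *\<^sub>R x))) integrable_on {0..1}" for x
    by (intro integrable_continuous_interval continuous_on continuous_intros
        continuous_on_compose2[OF cont_X]) auto
  have H_deriv: "(H has_derivative integral (cbox 0 1) (h' x)) (at x)" for x
    unfolding H_def cbox_interval[symmetric]
    by (rule leibniz_rule[where U = UNIV, OF _ _ cont_h']) (simp_all add: deriv integrable)
  moreover have "continuous_on UNIV (\<lambda>x. integral (cbox 0 1) (h' x))"
    by (rule integral_continuous_on_param[OF cont_h'])
  ultimately show "C1 H"
    unfolding C1_def by (intro exI[of _ "\<lambda>x. integral (cbox 0 1) (h' x)"]) simp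
  have "((\<lambda>t. t * b x (X (t *\<^sub>R x))) has_vector_derivative h' x t x) (at t within {0..1})" for t
  proof -
    have "((\<lambda>t. t *\<^sub>R x) has_vector_derivative x) (at t)"
      by (auto intro!: derivative_eq_intros)
    from vector_derivative_diff_chain_within[OF this has_derivative_at_withinI, OF X']
    have "((\<lambda>t. X (t *\<^sub>R x)) has_vector_derivative X' (t *\<^sub>R x) x) (at t)"
      by (simp add: o_def)
    from bounded_linear.has_vector_derivative[OF bounded_linear_right this, of x]
    have "((\<lambda>t. b x (X (t *\<^sub>R x))) has_real_derivative b x (X' (t *\<^sub>R x) x)) (at t)"
      by (simp add: has_real_derivative_iff_has_vector_derivative)
    from DERIV_mult[OF DERIV_ident this] show ?thesis
      by (simp add: h'_apply has_real_derivative_iff_has_vector_derivative[symmetric]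
          has_field_derivative_at_within algebra_simps)
  qed
  from fundamental_theorem_of_calculus[OF _ this]
  have "integral {0..1} (\<lambda>t. h' x t x) = b x (X x)"
    by (simp add: integral_unique)
  \<comment> \<open>Integrability of the operator-valued map allows evaluation at \<open>x\<close>
    to be moved under the integral.\<close>
  moreover have "h' x integrable_on cbox 0 1"
    by (rule integrable_continuous)
       (use continuous_on_compose2[OF cont_h'
           continuous_on_Pair[OF continuous_on_const continuous_on_id], of x "cbox 0 1"] in auto)
  ultimately show "frechet_derivative H (at x) x = b x (X x)"
    by (simp add: frechet_derivative_at[OF H_deriv, symmetric] blinfun_apply_integral)
qed

section \<open>Existence and uniqueness of the decompositions\<close>

text \<open>This explicit formula gives uniqueness and later the relation between the two
  potentials. Using \<open>has_integral\<close> lets two such formulas be subtracted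
  directly.\<close>

lemma right_decomposition_potential:
  fixes b :: "'a::euclidean_space \<Rightarrow> 'a \<Rightarrow> real"
  assumes b: "geometric_structure b" and dec: "right_decomposition b X H u"
  shows "((\<lambda>t. b x (X (t *\<^sub>R x))) has_integral H x) {0..1}"
  using radial_derivative_has_integral[of b H X x] b dec[unfolded right_decomposition_iff[OF b]]
  by (auto simp: geometric_structure_def)

lemma ex1_right_decomposition:
  fixes b :: "'a::euclidean_space \<Rightarrow> 'a \<Rightarrow> real"
  assumes X: "C1 X" and b: "geometric_structure b"
  shows "\<exists>!p. case p of (H, u) \<Rightarrow> right_decomposition b X H u"
proof -
  have bil: "bilinear b"
    using b by (simp add: geometric_structure_def)
  define H where "H x = integral {0..1} (\<lambda>t. b x (X (t *\<^sub>R x)))" for x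
  have dec: "right_decomposition b X H (\<lambda>x. X x - right_gradient b H x)"
    unfolding right_decomposition_iff[OF b] H_def
    using radial_potential[OF bil X] by (simp add: bilinear_lzero[OF bil])
  have unique: "K = H \<and> u = (\<lambda>x. X x - right_gradient b H x)"
    if "right_decomposition b X K u" for K u
  proof -
    have "K = H"
      using integral_unique[OF right_decomposition_potential[OF b that]]
      by (simp add: H_def fun_eq_iff)
    with that show ?thesis
      by (simp add: right_decomposition_iff[OF b])
  qed
  have "p = (H, \<lambda>x. X x - right_gradient b H x)"
    if "case p of (K, u) \<Rightarrow> right_decomposition b X K u" for p
    using that unique[of "fst p" "snd p"] by (simp add: case_prod_beta prod_eq_iff)
  with dec show ?thesis
    by (intro ex1I[of _ "(H, \<lambda>x. X x - right_gradient b H x)"]) simp_all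
qed

lemma ex1_left_decomposition:
  fixes b :: "'a::euclidean_space \<Rightarrow> 'a \<Rightarrow> real"
  assumes X: "C1 X" and b: "geometric_structure b"
  shows "\<exists>!p. case p of (H, u) \<Rightarrow> left_decomposition b X H u"
  using ex1_right_decomposition[OF X geometric_structure_transpose[OF b]]
  by (simp add: left_decomposition_transpose)

section \<open>Symmetric and skew-symmetric forms\<close>

lemma C1_uminus: "C1 F \<Longrightarrow> C1 (\<lambda>x. - F x)"
proof -
  assume "C1 F"
  then obtain F' where "\<And>x. (F has_derivative blinfun_apply (F' x)) (at x)" "continuous_on UNIV F'"
    by (auto simp: C1_def)
  then show "C1 (\<lambda>x. - F x)"
    unfolding C1_def
    by (intro exI[of _ "\<lambda>x. - F' x"])
       (auto intro!: continuous_intros derivative_eq_intros simp: blinfun.minus_left)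
qed

text \<open>Swapping the arguments of \<open>b\<close> costs a sign, which negating the potential
  absorbs: the right gradient of \<open>H\<close> is the left gradient of \<open>- H\<close>, so the
  remainder is unchanged.\<close>

lemma skew_left_decomposition:
  fixes b :: "'a::euclidean_space \<Rightarrow> 'a \<Rightarrow> real"
  assumes b: "geometric_structure b" and skew: "skew_symmetric_form b"
    and dec: "right_decomposition b X H u"
  shows "left_decomposition b X (\<lambda>x. - H x) u"
proof -
  have H: "C1 H"
    using dec by (simp add: right_decomposition_def)
  have neg: "b x y = - b y x" for x y
    using skew unfolding skew_symmetric_form_def by blast
  have "frechet_derivative (\<lambda>x. - H x) (at x) = (\<lambda>v. - frechet_derivative H (at x) v)" for x
    by (rule frechet_derivative_at[OF has_derivative_minus[OF C1_has_derivative[OF H]], symmetric])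
  then have "right_gradient b H = left_gradient b (\<lambda>x. - H x)"
    using neg[of "right_gradient b H _"] right_gradient[OF b H]
    by (simp flip: left_gradient_unique[OF b C1_uminus[OF H]])
  then show ?thesis
    using dec C1_uminus[OF H] neg[of "u _"]
    by (simp add: right_decomposition_def left_decomposition_def)
qed

text \<open>Under either symmetry, \<open>b x y\<close> and \<open>b y x\<close> vanish together, so
  the two orthogonality conditions merge into one.\<close>

lemma gradient_decomposition_eq_left:
  assumes "symmetric_form b \<or> skew_symmetric_form b"
  shows "gradient_decomposition b = left_decomposition b"
proof -
  have "b x y = 0 \<longleftrightarrow> b y x = 0" for x y
    using assms by (metis symmetric_form_def skew_symmetric_form_def neg_equal_0_iff_equal)
  then show ?thesis
    by (auto simp: fun_eq_iff gradient_decomposition_def left_decomposition_def gradient_def)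
qed

theorem theorem3p1:
  fixes X :: "real ^ 'n \<Rightarrow> real ^ 'n"
    and b :: "real ^ 'n \<Rightarrow> real ^ 'n \<Rightarrow> real"
  assumes "C1 X" and "geometric_structure b"
  shows
    "(\<exists>!p. case p of (H, u) \<Rightarrow> right_decomposition b X H u) \<and>
     (\<exists>!p. case p of (H, u) \<Rightarrow> left_decomposition b X H u) \<and>
     (\<forall>H u H' u'. right_decomposition b X H u \<and> left_decomposition b X H' u' \<longrightarrow>
        (\<forall>x. H' x = H x + 2 * integral {0..1} (\<lambda>t. skew_part b (X (t *\<^sub>R x)) x)) \<and>
        (symmetric_form b \<longrightarrow> H' = H \<and> u' = u) \<and>
        (skew_symmetric_form b \<longrightarrow> H' = (\<lambda>x. - H x) \<and> u' = u)) \<and>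
     (symmetric_form b \<or> skew_symmetric_form b \<longrightarrow>
        (\<exists>!p. case p of (H, u) \<Rightarrow> gradient_decomposition b X H u)) \<and>
     (skew_symmetric_form b \<longrightarrow>
        (\<forall>H Y. C1 H \<longrightarrow> (is_hamiltonian_vector_field b H Y \<longleftrightarrow> Y = gradient b H)))"
proof (intro conjI allI impI; (elim conjE)?)
  note b = assms(2) and bT = geometric_structure_transpose[OF assms(2)]
  show "\<exists>!p. case p of (H, u) \<Rightarrow> right_decomposition b X H u"
    by (rule ex1_right_decomposition[OF assms])
  show left: "\<exists>!p. case p of (H, u) \<Rightarrow> left_decomposition b X H u"
    by (rule ex1_left_decomposition[OF assms])
  then show "\<exists>!p. case p of (H, u) \<Rightarrow> gradient_decomposition b X H u"
    if "symmetric_form b \<or> skew_symmetric_form b"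
    by (simp add: gradient_decomposition_eq_left[OF that])
  show "is_hamiltonian_vector_field b H Y \<longleftrightarrow> Y = gradient b H" if "C1 H" for H Y
    unfolding is_hamiltonian_vector_field_def gradient_def by (rule left_gradient_unique[OF b that])
  \<comment> \<open>Both symmetry cases show that the right decomposition yields a left one and then
    compare it with the given left one.\<close>
  have left_unique: "H' = H \<and> u' = u"
    if "left_decomposition b X H u" "left_decomposition b X H' u'" for H u H' u'
    using left that by auto
  fix H u H' u'
  assume R: "right_decomposition b X H u" and L: "left_decomposition b X H' u'"
  show "H' x = H x + 2 * integral {0..1} (\<lambda>t. skew_part b (X (t *\<^sub>R x)) x)" for x
  proof -
    \<comment> \<open>The potential formula for the transposed form. Its integrand minus that for
      \<open>H\<close> is twice the skew part.\<close>
    have "((\<lambda>t. b (X (t *\<^sub>R x)) x) has_integral H' x) {0..1}"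
      using right_decomposition_potential[OF bT] L by (simp add: left_decomposition_transpose)
    from integral_unique[OF has_integral_diff[OF this right_decomposition_potential[OF b R, of x]]]
    show ?thesis
      by (simp add: skew_part_def field_simps)
  qed
  {
    assume "symmetric_form b"
    then have "left_decomposition b = right_decomposition b"
      by (metis (no_types, lifting) ext left_decomposition_transpose symmetric_form_def)
    then show "H' = H" "u' = u"
      using left_unique[OF _ L] R by auto
  next
    assume "skew_symmetric_form b"
    from left_unique[OF skew_left_decomposition[OF b this R] L]
    show "H' = (\<lambda>x. - H x)" "u' = u"
      by auto
  }
qed

end
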